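(* If $B:\mathbb{R}_+^2\to\mathbb{R}_+$ is increasing and homogeneous of degree $1$, then the log-convexity inequality $$D^2(\log u)\ge -\frac{A}{2t} \qquad (\ast)$$ is preserved under $B$ if and only if the function $\Theta:\mathbb{R}^2\to\mathbb{R}$ given by $\Theta(x_1,x_2):=\log B(e^{x_1},e^{x_2})$ is convex. Here "preserved under $B$" means: whenever $u_1,u_2:\mathbb{R}_+\times\mathbb{R}^n\to\mathbb{R}_+$ both satisfy $(\ast)$, so does $B(u_1,u_2)$. Moreover, if the scalar function $h:=\Theta(0,\cdot):\mathbb{R}\to\mathbb{R}$ is strictly concave, then there exist solutions $u_1,u_2:\mathbb{R}_+\times\mathbb{R}^n\to\mathbb{R}_+$ of the heat equation $\partial_t u=\operatorname{div}(A^{-1}\nabla u)$ for which $\widetilde u:=B(u_1,u_2)$ fails to satisfy $D^2(\log\widetilde u)\ge-\frac{A}{2t}$ at every point $(t,x)\in\mathbb{R}_+\times\mathbb{R}^n$.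
   Context: $A$ is a real symmetric positive-definite $n\times n$ matrix, and $\mathbb{R}_+$ denotes the positive real numbers. Functions $u(t,x)$ have time variable $t\in\mathbb{R}_+$ and space variable $x\in\mathbb{R}^n$; $\operatorname{div}$, $\nabla$ and the Hessian $D^2$ act in the space variable $x$ only. Functions are understood to be sufficiently regular for the expressions involved to make sense. "Increasing" means increasing in each variable. Homogeneous of degree $1$ means $B(rx)=rB(x)$ for all $r>0$ and $x\in\mathbb{R}_+^2$. A matrix inequality $P\ge Q$ means that $P-Q$ is positive semidefinite.
   Formalization: In the "Moreover" part, "strictly concave" is read as h''<0 everywhere: the claim fails if h'' vanishes at some point. For merely strictly concave h, failure is shown on a dense set of x for every t>0. B is taken to be C², and u_1,u_2 are C² in x. *)

theory Defs
  imports "HOL-Analysis.Analysis"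
begin

definition C2_on :: "'a::real_normed_vector set \<Rightarrow> ('a \<Rightarrow> real) \<Rightarrow> bool" where
  "C2_on S f \<longleftrightarrow>
     (\<exists>(f' :: 'a \<Rightarrow> 'a \<Rightarrow>\<^sub>L real) (f'' :: 'a \<Rightarrow> 'a \<Rightarrow>\<^sub>L ('a \<Rightarrow>\<^sub>L real)).
        (\<forall>x\<in>S. (f has_derivative blinfun_apply (f' x)) (at x)) \<and>
        (\<forall>x\<in>S. (f' has_derivative blinfun_apply (f'' x)) (at x)) \<and>
        continuous_on S f'')"

definition partial :: "'n::finite \<Rightarrow> (real ^ 'n \<Rightarrow> real) \<Rightarrow> real ^ 'n \<Rightarrow> real" where
  "partial i f x = deriv (\<lambda>s. f (x + s *\<^sub>R axis i 1)) 0"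

definition grad :: "(real ^ 'n::finite \<Rightarrow> real) \<Rightarrow> real ^ 'n \<Rightarrow> real ^ 'n" where
  "grad f x = (\<chi> i. partial i f x)"

definition divergence :: "(real ^ 'n::finite \<Rightarrow> real ^ 'n) \<Rightarrow> real ^ 'n \<Rightarrow> real" where
  "divergence F x = (\<Sum>i\<in>UNIV. partial i (\<lambda>y. F y $ i) x)"

definition hessian :: "(real ^ 'n::finite \<Rightarrow> real) \<Rightarrow> real ^ 'n \<Rightarrow> real ^ 'n ^ 'n" where
  "hessian f x = (\<chi> i j. partial i (partial j f) x)"

definition symmetric_pos_def :: "real ^ 'n ^ 'n::finite \<Rightarrow> bool" where
  "symmetric_pos_def A \<longleftrightarrow> transpose A = A \<and> (\<forall>v. v \<noteq> 0 \<longrightarrow> 0 < v \<bullet> (A *v v))"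

(* Only applied to symmetric matrices (A, and Hessians of C^2 functions), so
   symmetry is not demanded again. *)
definition pos_semidef :: "real ^ 'n ^ 'n::finite \<Rightarrow> bool" where
  "pos_semidef P \<longleftrightarrow> (\<forall>v. 0 \<le> v \<bullet> (P *v v))"

definition matrix_ge :: "real ^ 'n ^ 'n::finite \<Rightarrow> real ^ 'n ^ 'n \<Rightarrow> bool" where
  "matrix_ge P Q \<longleftrightarrow> pos_semidef (P - Q)"

(* Functions on R_+ x R^n are total functions of type real => real^'n => real of
   which only the values at positive times are used. *)
definition positive_on_times :: "(real \<Rightarrow> real ^ 'n::finite \<Rightarrow> real) \<Rightarrow> bool" where
  "positive_on_times u \<longleftrightarrow> (\<forall>t>0. \<forall>x. 0 < u t x)"

definition log_convex_at ::
  "real ^ 'n ^ 'n::finite \<Rightarrow> (real \<Rightarrow> real ^ 'n \<Rightarrow> real) \<Rightarrow> real \<Rightarrow> real ^ 'n \<Rightarrow> bool" where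
  "log_convex_at A u t x \<longleftrightarrow> matrix_ge (hessian (\<lambda>y. ln (u t y)) x) (- (1 / (2 * t)) *\<^sub>R A)"

definition log_convexity ::
  "real ^ 'n ^ 'n::finite \<Rightarrow> (real \<Rightarrow> real ^ 'n \<Rightarrow> real) \<Rightarrow> bool" where
  "log_convexity A u \<longleftrightarrow> (\<forall>t>0. \<forall>x. log_convex_at A u t x)"

definition combine ::
  "(real \<times> real \<Rightarrow> real) \<Rightarrow> (real \<Rightarrow> real ^ 'n::finite \<Rightarrow> real) \<Rightarrow> (real \<Rightarrow> real ^ 'n \<Rightarrow> real) \<Rightarrow>
    real \<Rightarrow> real ^ 'n \<Rightarrow> real" where
  "combine B u1 u2 = (\<lambda>t x. B (u1 t x, u2 t x))"

(* The inequality only involves space derivatives, so C^2 regularity in space at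
   each time is all that is asked of the functions. *)
definition preserves_log_convexity ::
  "real ^ 'n ^ 'n::finite \<Rightarrow> (real \<times> real \<Rightarrow> real) \<Rightarrow> bool" where
  "preserves_log_convexity A B \<longleftrightarrow>
     (\<forall>u1 u2 :: real \<Rightarrow> real ^ 'n \<Rightarrow> real.
        positive_on_times u1 \<longrightarrow> positive_on_times u2 \<longrightarrow>
        (\<forall>t>0. C2_on UNIV (u1 t)) \<longrightarrow> (\<forall>t>0. C2_on UNIV (u2 t)) \<longrightarrow>
        log_convexity A u1 \<longrightarrow> log_convexity A u2 \<longrightarrow>
        log_convexity A (combine B u1 u2))"

abbreviation quadrant :: "(real \<times> real) set" where
  "quadrant \<equiv> {0<..} \<times> {0<..}"

(* Weak monotonicity; the strictly increasing B are a special case. *)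
definition increasing_each :: "(real \<times> real \<Rightarrow> real) \<Rightarrow> bool" where
  "increasing_each B \<longleftrightarrow>
     (\<forall>a>0. \<forall>b>0. \<forall>c\<ge>a. B (a, b) \<le> B (c, b)) \<and>
     (\<forall>a>0. \<forall>b>0. \<forall>c\<ge>b. B (a, b) \<le> B (a, c))"

definition homogeneous_1 :: "(real \<times> real \<Rightarrow> real) \<Rightarrow> bool" where
  "homogeneous_1 B \<longleftrightarrow> (\<forall>r>0. \<forall>x\<in>quadrant. B (r *\<^sub>R x) = r * B x)"

definition Theta :: "(real \<times> real \<Rightarrow> real) \<Rightarrow> real \<times> real \<Rightarrow> real" where
  "Theta B x = ln (B (exp (fst x), exp (snd x)))"

definition strictly_concave :: "(real \<Rightarrow> real) \<Rightarrow> bool" where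
  "strictly_concave h \<longleftrightarrow>
     (\<forall>x y \<mu>. x \<noteq> y \<longrightarrow> 0 < \<mu> \<longrightarrow> \<mu> < 1 \<longrightarrow>
        \<mu> * h x + (1 - \<mu>) * h y < h (\<mu> * x + (1 - \<mu>) * y))"

(* Strict concavity of a C^2 function in the differential sense.  This is strictly
   stronger than strictly_concave, and a statement about the Hessian at every single
   point needs it: where h'' vanishes, Theta is infinitesimally affine and the
   inequality for u1 and u2 passes to B(u1,u2). *)
definition differentially_strictly_concave :: "(real \<Rightarrow> real) \<Rightarrow> bool" where
  "differentially_strictly_concave h \<longleftrightarrow> (\<forall>s. deriv (deriv h) s < 0)"

definition positive_heat_solution ::
  "real ^ 'n ^ 'n::finite \<Rightarrow> (real \<Rightarrow> real ^ 'n \<Rightarrow> real) \<Rightarrow> bool" where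
  "positive_heat_solution A u \<longleftrightarrow>
     positive_on_times u \<and>
     C2_on ({0<..} \<times> UNIV) (\<lambda>(t, x). u t x) \<and>
     (\<forall>t>0. \<forall>x. ((\<lambda>s. u s x) has_real_derivative
        divergence (\<lambda>y. matrix_inv A *v grad (u t) y) x) (at t))"

end

theory Submission
  imports Defs
begin

text \<open>Homogeneity gives \<open>\<Theta>(x, y) = x + h (y - x)\<close> with the one-variable profile
  \<open>h = \<Theta>(0, \<cdot>)\<close>. So if \<open>v\<^sub>1 = ln u\<^sub>1\<close> and \<open>v\<^sub>2 = ln u\<^sub>2\<close>, then
  \<open>ln (B (u\<^sub>1, u\<^sub>2)) = v\<^sub>1 + h (v\<^sub>2 - v\<^sub>1)\<close>, and its second derivative in a direction \<open>e\<close> is the sum of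
  \<open>(1 - h') D\<^sup>2v\<^sub>1(e, e) + h' D\<^sup>2v\<^sub>2(e, e)\<close> and \<open>h'' (\<partial>\<^sub>e(v\<^sub>2 - v\<^sub>1))\<^sup>2\<close>,
  where \<open>h'\<close> and \<open>h''\<close> are taken at \<open>v\<^sub>2 - v\<^sub>1\<close> (lemma \<open>log_convex_at_combine_iff\<close>). Monotonicity of
  \<open>B\<close> in its two variables means \<open>0 \<le> h' \<le> 1\<close> (\<open>profile_derivative_bounds\<close>), so the first two terms
  form a convex combination and inherit a common lower bound \<open>-A/2t\<close>. The last term is nonnegative
  if \<open>h'' \<ge> 0\<close>, which is convexity of \<open>\<Theta>\<close> (\<open>convex_on_Theta_iff\<close>).

  Heat kernels show that \<open>h'' \<ge> 0\<close> cannot be dispensed with. The logarithm of a heat kernel has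
  Hessian exactly \<open>-A/2t\<close>, and the difference of the logarithms of two kernels with different
  centres is a nonconstant affine function of \<open>x\<close>. For such a pair the inequality for
  \<open>B (u\<^sub>1, u\<^sub>2)\<close> at \<open>(t, x)\<close> therefore holds if and only if \<open>h'' \<ge> 0\<close> at \<open>v\<^sub>2 - v\<^sub>1\<close>
  (\<open>log_convex_at_combine_heat_kernels\<close>). All negative assertions follow from this equivalence for a
  single pair of kernels: the affine function takes every real value, so preservation forces
  \<open>h'' \<ge> 0\<close> everywhere; if \<open>h'' < 0\<close> everywhere then the inequality fails everywhere; and if \<open>h\<close> is
  strictly concave then \<open>h'' < 0\<close> on a dense set, whose preimage under the affine function is dense.\<close>

section \<open>Twice continuously differentiable functions\<close>

lemma C2_on_const: "C2_on S (\<lambda>_. c)"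
  unfolding C2_on_def
  by (rule exI[of _ "\<lambda>_. 0"], rule exI[of _ "\<lambda>_. 0"]) (auto intro!: derivative_eq_intros)

lemma C2_on_bounded_linear:
  assumes "bounded_linear f"
  shows "C2_on S f"
  unfolding C2_on_def
  by (rule exI[of _ "\<lambda>_. Blinfun f"], rule exI[of _ "\<lambda>_. 0"])
    (auto simp: bounded_linear_Blinfun_apply[OF assms]
      intro!: derivative_eq_intros bounded_linear.has_derivative[OF assms])

lemma C2_on_add:
  assumes "C2_on S f" "C2_on S g"
  shows "C2_on S (\<lambda>x. f x + g x)"
proof -
  obtain f' f'' where f: "\<And>x. x \<in> S \<Longrightarrow> (f has_derivative blinfun_apply (f' x)) (at x)"
      "\<And>x. x \<in> S \<Longrightarrow> (f' has_derivative blinfun_apply (f'' x)) (at x)" "continuous_on S f''"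
    using assms(1) unfolding C2_on_def by auto
  obtain g' g'' where g: "\<And>x. x \<in> S \<Longrightarrow> (g has_derivative blinfun_apply (g' x)) (at x)"
      "\<And>x. x \<in> S \<Longrightarrow> (g' has_derivative blinfun_apply (g'' x)) (at x)" "continuous_on S g''"
    using assms(2) unfolding C2_on_def by auto
  show ?thesis
    unfolding C2_on_def
    by (rule exI[of _ "\<lambda>x. f' x + g' x"], rule exI[of _ "\<lambda>x. f'' x + g'' x"])
      (auto simp: plus_blinfun.rep_eq intro!: has_derivative_add f g continuous_intros)
qed

lemma C2_on_mult:
  assumes "C2_on S f" "C2_on S g"
  shows "C2_on S (\<lambda>x. f x * g x)"
proof -
  obtain f' f'' where f: "\<And>x. x \<in> S \<Longrightarrow> (f has_derivative blinfun_apply (f' x)) (at x)"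
      "\<And>x. x \<in> S \<Longrightarrow> (f' has_derivative blinfun_apply (f'' x)) (at x)" "continuous_on S f''"
    using assms(1) unfolding C2_on_def by auto
  obtain g' g'' where g: "\<And>x. x \<in> S \<Longrightarrow> (g has_derivative blinfun_apply (g' x)) (at x)"
      "\<And>x. x \<in> S \<Longrightarrow> (g' has_derivative blinfun_apply (g'' x)) (at x)" "continuous_on S g''"
    using assms(2) unfolding C2_on_def by auto
  have cont: "continuous_on S f" "continuous_on S g" "continuous_on S f'" "continuous_on S g'"
    using f(1,2) g(1,2)
    by (meson continuous_at_imp_continuous_on has_derivative_continuous)+
  \<comment> \<open>In the second derivative of the product, \<open>blinfun_scaleR_left (g' x) o\<^sub>L f' x\<close> is the rank-one
    form sending \<open>(v, w)\<close> to \<open>f' x v * g' x w\<close>.\<close>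
  let ?D = "\<lambda>x. f x *\<^sub>R g' x + g x *\<^sub>R f' x"
  let ?DD = "\<lambda>x. (f x *\<^sub>R g'' x + (blinfun_scaleR_left (g' x) o\<^sub>L f' x)) +
          (g x *\<^sub>R f'' x + (blinfun_scaleR_left (f' x) o\<^sub>L g' x))"
  show ?thesis
    unfolding C2_on_def
  proof (rule exI[of _ ?D], rule exI[of _ ?DD], intro conjI ballI)
    fix x assume x: "x \<in> S"
    show "((\<lambda>x. f x * g x) has_derivative
        blinfun_apply (?D x)) (at x)"
      by (auto intro!: derivative_eq_intros f(1)[OF x] g(1)[OF x]
          simp: plus_blinfun.rep_eq scaleR_blinfun.rep_eq fun_eq_iff)
    show "(?D has_derivative
        blinfun_apply (?DD x)) (at x)"
      by (auto intro!: derivative_eq_intros f(1,2)[OF x] g(1,2)[OF x]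
          simp: plus_blinfun.rep_eq scaleR_blinfun.rep_eq fun_eq_iff)
  next
    show "continuous_on S ?DD"
      by (intro continuous_intros cont f g)
  qed
qed

lemma C2_on_sum:
  assumes "\<And>i. i \<in> I \<Longrightarrow> C2_on S (f i)"
  shows "C2_on S (\<lambda>x. \<Sum>i\<in>I. f i x)"
  using assms by (induction I rule: infinite_finite_induct) (simp_all add: C2_on_const C2_on_add)

lemma C2_on_compose_real:
  fixes \<phi> :: "real \<Rightarrow> real"
  assumes "C2_on S f" and im: "f ` S \<subseteq> T"
    and \<phi>: "\<And>y. y \<in> T \<Longrightarrow> (\<phi> has_real_derivative \<phi>' y) (at y)"
      "\<And>y. y \<in> T \<Longrightarrow> (\<phi>' has_real_derivative \<phi>'' y) (at y)" "continuous_on T \<phi>''"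
  shows "C2_on S (\<lambda>x. \<phi> (f x))"
proof -
  obtain f' f'' where f: "\<And>x. x \<in> S \<Longrightarrow> (f has_derivative blinfun_apply (f' x)) (at x)"
      "\<And>x. x \<in> S \<Longrightarrow> (f' has_derivative blinfun_apply (f'' x)) (at x)" "continuous_on S f''"
    using assms(1) unfolding C2_on_def by auto
  have cont: "continuous_on S f" "continuous_on S f'" "continuous_on T \<phi>'"
    using f(1,2) \<phi>(2)
    by (meson DERIV_isCont continuous_at_imp_continuous_on has_derivative_continuous)+
  have cont\<phi>: "continuous_on S (\<lambda>x. \<phi>' (f x))" "continuous_on S (\<lambda>x. \<phi>'' (f x))"
    using continuous_on_compose2[OF _ cont(1) im] cont(3) \<phi>(3) by auto
  let ?D = "\<lambda>x. \<phi>' (f x) *\<^sub>R f' x"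
  let ?DD = "\<lambda>x. \<phi>' (f x) *\<^sub>R f'' x +
          (blinfun_scaleR_left (\<phi>'' (f x) *\<^sub>R f' x) o\<^sub>L f' x)"
  show ?thesis
    unfolding C2_on_def
  proof (rule exI[of _ ?D], rule exI[of _ ?DD], intro conjI ballI)
    fix x assume x: "x \<in> S"
    then have y: "f x \<in> T" using im by auto
    note d = has_derivative_compose[OF f(1)[OF x] \<phi>(1)[OF y, THEN has_field_derivative_imp_has_derivative]]
      has_derivative_compose[OF f(1)[OF x] \<phi>(2)[OF y, THEN has_field_derivative_imp_has_derivative]]
    show "((\<lambda>x. \<phi> (f x)) has_derivative blinfun_apply (?D x)) (at x)"
      using d(1) by (simp add: scaleR_blinfun.rep_eq)
    show "(?D has_derivative
        blinfun_apply (?DD x)) (at x)"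
      using has_derivative_scaleR[OF d(2) f(2)[OF x]]
      by (rule has_derivative_eq_rhs)
        (auto simp: plus_blinfun.rep_eq scaleR_blinfun.rep_eq fun_eq_iff mult.commute)
  next
    show "continuous_on S ?DD"
      by (intro continuous_intros cont cont\<phi> f)
  qed
qed

section \<open>Hessians and second directional derivatives\<close>

text \<open>In \<open>f'' x v w\<close> the function is differentiated first along \<open>v\<close> and then along \<open>w\<close>. The
  derivatives are plain functions, not bounded linear maps, so that the rules for scalar
  derivatives apply in each fixed direction \<open>v\<close>.\<close>
definition second_derivatives ::
  "('a::real_normed_vector \<Rightarrow> real) \<Rightarrow> ('a \<Rightarrow> 'a \<Rightarrow> real) \<Rightarrow> ('a \<Rightarrow> 'a \<Rightarrow> 'a \<Rightarrow> real) \<Rightarrow> bool" where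
  "second_derivatives f f' f'' \<longleftrightarrow>
     (\<forall>x. (f has_derivative f' x) (at x)) \<and>
     (\<forall>x v. ((\<lambda>y. f' y v) has_derivative f'' x v) (at x))"

lemma partial_eq:
  assumes "(f has_derivative D) (at x)"
  shows "partial i f x = D (axis i 1)"
proof -
  interpret bounded_linear D using assms by (rule has_derivative_bounded_linear)
  have "((\<lambda>s. f (x + s *\<^sub>R axis i 1)) has_derivative (\<lambda>s. D (s *\<^sub>R axis i 1))) (at 0)"
    by (rule has_derivative_compose[where g = f])
      (auto intro!: derivative_eq_intros simp: assms)
  then have "((\<lambda>s. f (x + s *\<^sub>R axis i 1)) has_real_derivative D (axis i 1)) (at 0)"
    unfolding has_field_derivative_def by (rule has_derivative_eq_rhs) (auto simp: scaleR)
  then show ?thesis unfolding partial_def by (rule DERIV_imp_deriv)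
qed

lemma linear_sum_axis:
  fixes D :: "real ^ 'n::finite \<Rightarrow> real"
  assumes "linear D"
  shows "(\<Sum>i\<in>UNIV. v $ i * D (axis i 1)) = D v"
proof -
  have "D v = D (\<Sum>i\<in>UNIV. v $ i *\<^sub>R axis i 1)"
    by (simp add: basis_expansion scalar_mult_eq_scaleR[symmetric])
  then show ?thesis by (simp add: linear_sum[OF assms] linear_scale[OF assms])
qed

text \<open>The entries of the Hessian are the values of \<open>f'' x\<close> on pairs of axes. Linearity of \<open>f'' x v w\<close>
  in \<open>w\<close> is part of being a derivative; linearity in \<open>v\<close> is inherited from \<open>f' y v\<close> by uniqueness
  of derivatives.\<close>
lemma hessian_quadratic_form:
  fixes f :: "real ^ 'n::finite \<Rightarrow> real"
  assumes "second_derivatives f f' f''"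
  shows "v \<bullet> (hessian f x *v v) = f'' x v v"
proof -
  have f: "\<And>x. (f has_derivative f' x) (at x)" "\<And>x v. ((\<lambda>y. f' y v) has_derivative f'' x v) (at x)"
    using assms unfolding second_derivatives_def by auto
  have lin: "linear (f' y)" "linear (f'' y w)" for y w
    using f by (metis has_derivative_linear)+
  have "partial j f = (\<lambda>y. f' y (axis j 1))" for j
    using partial_eq[OF f(1)] by auto
  then have H: "hessian f x $ i $ j = f'' x (axis j 1) (axis i 1)" for i j
    unfolding hessian_def using partial_eq[OF f(2)] by simp
  have "v \<bullet> (hessian f x *v v) = (\<Sum>i\<in>UNIV. v $ i * (\<Sum>j\<in>UNIV. f'' x (axis j 1) (axis i 1) * v $ j))"
    by (simp add: inner_vec_def matrix_vector_mult_def H)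
  also have "\<dots> = (\<Sum>i\<in>UNIV. \<Sum>j\<in>UNIV. v $ j * (v $ i * f'' x (axis j 1) (axis i 1)))"
    by (simp add: sum_distrib_left mult_ac)
  also have "\<dots> = (\<Sum>j\<in>UNIV. \<Sum>i\<in>UNIV. v $ j * (v $ i * f'' x (axis j 1) (axis i 1)))"
    by (rule sum.swap)
  also have "\<dots> = (\<Sum>j\<in>UNIV. v $ j * f'' x (axis j 1) v)"
    by (simp add: linear_sum_axis[OF lin(2)] flip: sum_distrib_left)
  also have "\<dots> = f'' x v v"
  proof -
    have "((\<lambda>y. \<Sum>j\<in>UNIV. v $ j * f' y (axis j 1)) has_derivative
        (\<lambda>w. \<Sum>j\<in>UNIV. v $ j * f'' x (axis j 1) w)) (at x)"
      by (auto intro!: derivative_eq_intros f(2))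
    then have "((\<lambda>y. f' y v) has_derivative (\<lambda>w. \<Sum>j\<in>UNIV. v $ j * f'' x (axis j 1) w)) (at x)"
      by (simp add: linear_sum_axis[OF lin(1)])
    from has_derivative_unique[OF this f(2)] show ?thesis by (rule fun_cong)
  qed
  finally show ?thesis .
qed

lemma C2_on_imp_second_derivatives:
  assumes "C2_on UNIV f"
  obtains f' f'' where "second_derivatives f f' f''"
proof -
  obtain f' f'' where f: "\<And>x. (f has_derivative blinfun_apply (f' x)) (at x)"
      "\<And>x. (f' has_derivative blinfun_apply (f'' x)) (at x)"
    using assms unfolding C2_on_def by auto
  have "second_derivatives f (\<lambda>x. blinfun_apply (f' x)) (\<lambda>x v w. blinfun_apply (blinfun_apply (f'' x) w) v)"
    unfolding second_derivatives_def
    by (auto intro!: f bounded_linear.has_derivative[OF blinfun.bounded_linear_left])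
  then show ?thesis by (rule that)
qed

lemma second_derivatives_ln:
  assumes "second_derivatives f f' f''" and pos: "\<And>x. 0 < f x"
  shows "second_derivatives (\<lambda>x. ln (f x)) (\<lambda>x v. f' x v / f x)
    (\<lambda>x v w. f'' x v w / f x - f' x v * f' x w / (f x)\<^sup>2)"
proof -
  have f: "\<And>x. (f has_derivative f' x) (at x)" "\<And>x v. ((\<lambda>y. f' y v) has_derivative f'' x v) (at x)"
    using assms unfolding second_derivatives_def by auto
  have nz: "f x \<noteq> 0" for x using pos[of x] by simp
  show ?thesis
    unfolding second_derivatives_def
    by (auto intro!: derivative_eq_intros f pos nz simp: fun_eq_iff nz field_simps power2_eq_square)
qed

text \<open>If \<open>h\<close> is affine this interpolates linearly between \<open>a\<close> and \<open>b\<close>. The curvature of \<open>h\<close> adds a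
  rank-one term, the square of the derivative of \<open>b - a\<close>.\<close>
lemma second_derivatives_interpolation:
  assumes "second_derivatives a a' a''" "second_derivatives b b' b''"
    and h: "\<And>s. (h has_real_derivative h' s) (at s)" "\<And>s. (h' has_real_derivative h'' s) (at s)"
  defines "d \<equiv> \<lambda>x. b x - a x"
  shows "second_derivatives (\<lambda>x. a x + h (d x))
    (\<lambda>x v. (1 - h' (d x)) * a' x v + h' (d x) * b' x v)
    (\<lambda>x v w. (1 - h' (d x)) * a'' x v w + h' (d x) * b'' x v w +
       h'' (d x) * (b' x v - a' x v) * (b' x w - a' x w))"
proof -
  have ab: "\<And>x. (a has_derivative a' x) (at x)" "\<And>x v. ((\<lambda>y. a' y v) has_derivative a'' x v) (at x)"
    "\<And>x. (b has_derivative b' x) (at x)" "\<And>x v. ((\<lambda>y. b' y v) has_derivative b'' x v) (at x)"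
    using assms unfolding second_derivatives_def by auto
  have d: "(d has_derivative (\<lambda>v. b' x v - a' x v)) (at x)" for x
    unfolding d_def by (intro has_derivative_diff ab)
  note hd = has_derivative_compose[OF d h(1)[THEN has_field_derivative_imp_has_derivative]]
    has_derivative_compose[OF d h(2)[THEN has_field_derivative_imp_has_derivative]]
  show ?thesis
    unfolding second_derivatives_def
    by (auto intro!: derivative_eq_intros ab hd simp: fun_eq_iff algebra_simps)
qed

lemma C2_on_imp_ln_second_derivatives:
  assumes "C2_on UNIV f" and pos: "\<And>x. 0 < f x"
  obtains f' f'' where "second_derivatives (\<lambda>x. ln (f x)) f' f''"
proof -
  obtain f' f'' where "second_derivatives f f' f''"
    using C2_on_imp_second_derivatives[OF assms(1)] .
  from that[OF second_derivatives_ln[OF this pos]] show ?thesis .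
qed

lemma log_convex_at_iff:
  assumes "second_derivatives (\<lambda>y. ln (u t y)) f' f''"
  shows "log_convex_at A u t x \<longleftrightarrow> (\<forall>v. 0 \<le> f'' x v v + (v \<bullet> (A *v v)) / (2 * t))"
  unfolding log_convex_at_def matrix_ge_def pos_semidef_def
  by (simp add: matrix_vector_mult_add_rdistrib inner_add_right hessian_quadratic_form[OF assms]
      flip: scaleR_matrix_vector_assoc)

section \<open>Heat kernels\<close>

text \<open>This is \<open>t\<^bsup>-n/2\<^esup> exp (- (x - p) \<bullet> A (x - p) / 4t)\<close>, the fundamental solution of
  \<open>\<partial>\<^sub>t u = div (A\<^sup>-\<^sup>1 \<nabla> u)\<close> up to a constant factor. The power of \<open>t\<close> is put into the exponent so
  that the logarithm is immediate.\<close>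
definition heat_kernel :: "real ^ 'n ^ 'n::finite \<Rightarrow> real ^ 'n \<Rightarrow> real \<Rightarrow> real ^ 'n \<Rightarrow> real" where
  "heat_kernel A p t x =
     exp (- (real CARD('n) / 2) * ln t - ((x - p) \<bullet> (A *v (x - p))) / (4 * t))"

lemma heat_kernel_pos: "0 < heat_kernel A p t x"
  by (simp add: heat_kernel_def)

lemma symmetric_inner_commute:
  fixes A :: "real ^ 'n ^ 'n::finite"
  assumes "symmetric_pos_def A"
  shows "v \<bullet> (A *v w) = w \<bullet> (A *v v)"
  using assms unfolding symmetric_pos_def_def
  by (metis dot_lmul_matrix inner_commute vector_transpose_matrix)

text \<open>Time and space are functions \<open>\<tau>\<close> and \<open>\<xi>\<close> of the point \<open>z\<close>: the two projections give regularity in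
  \<open>(t, x)\<close> jointly, a constant \<open>\<tau>\<close> and the identity give regularity in \<open>x\<close> at a fixed time.\<close>
lemma C2_on_heat_kernel:
  fixes \<tau> :: "'a::real_normed_vector \<Rightarrow> real" and \<xi> :: "'a \<Rightarrow> real ^ 'n::finite"
  assumes \<tau>: "C2_on S \<tau>" "\<tau> ` S \<subseteq> {0<..}" and \<xi>: "bounded_linear \<xi>"
  shows "C2_on S (\<lambda>z. heat_kernel A p (\<tau> z) (\<xi> z))"
proof -
  have "C2_on S (\<lambda>z. \<xi> z $ i + - (p $ i))" for i
    by (intro C2_on_add C2_on_const C2_on_bounded_linear
        bounded_linear_compose[OF bounded_linear_vec_nth \<xi>])
  then have coord: "C2_on S (\<lambda>z. (\<xi> z - p) $ i)" for i
    by simp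
  have "C2_on S (\<lambda>z. (\<xi> z - p) \<bullet> (A *v (\<xi> z - p)))"
    unfolding inner_vec_def matrix_vector_mult_def inner_real_def vec_lambda_beta
    by (intro C2_on_sum C2_on_mult C2_on_const coord)
  moreover have "C2_on S (\<lambda>z. ln (\<tau> z))"
  proof (rule C2_on_compose_real[OF \<tau>])
    show "(ln has_real_derivative inverse y) (at y)" if "y \<in> {0<..}" for y :: real
      using that by (auto intro!: derivative_eq_intros simp: inverse_eq_divide)
    show "(inverse has_real_derivative - (inverse y * inverse y)) (at y)" if "y \<in> {0<..}" for y :: real
      using that by (auto intro!: derivative_eq_intros)
  qed (auto intro!: continuous_intros)
  moreover have "C2_on S (\<lambda>z. inverse (\<tau> z))"
  proof (rule C2_on_compose_real[OF \<tau>])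
    show "(inverse has_real_derivative - (inverse y * inverse y)) (at y)" if "y \<in> {0<..}" for y :: real
      using that by (auto intro!: derivative_eq_intros)
    show "((\<lambda>y. - (inverse y * inverse y)) has_real_derivative 2 * inverse y ^ 3) (at y)"
      if "y \<in> {0<..}" for y :: real
      using that by (auto intro!: derivative_eq_intros simp: field_simps power3_eq_cube)
  qed (auto intro!: continuous_intros)
  ultimately have "C2_on S (\<lambda>z. - (real CARD('n) / 2) * ln (\<tau> z) +
      (- 1 / 4) * (((\<xi> z - p) \<bullet> (A *v (\<xi> z - p))) * inverse (\<tau> z)))"
    by (intro C2_on_add C2_on_mult C2_on_const)
  then have "C2_on S (\<lambda>z. exp (- (real CARD('n) / 2) * ln (\<tau> z) +
      (- 1 / 4) * (((\<xi> z - p) \<bullet> (A *v (\<xi> z - p))) * inverse (\<tau> z))))"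
    by (rule C2_on_compose_real[where T = UNIV and \<phi>' = exp and \<phi>'' = exp])
      (auto intro!: derivative_eq_intros continuous_intros)
  then show ?thesis
    by (simp add: heat_kernel_def field_simps)
qed

lemma quadratic_form_has_derivative:
  fixes A :: "real ^ 'n ^ 'n::finite"
  assumes "symmetric_pos_def A"
  shows "((\<lambda>x. (x - p) \<bullet> (A *v (x - p))) has_derivative (\<lambda>v. 2 * ((x - p) \<bullet> (A *v v)))) (at x)"
proof -
  have "((\<lambda>x. A *v (x - p)) has_derivative (\<lambda>v. A *v v)) (at x)"
    by (rule bounded_linear.has_derivative[OF matrix_vector_mul_bounded_linear])
      (auto intro!: derivative_eq_intros)
  moreover have "((\<lambda>x. x - p) has_derivative (\<lambda>v. v)) (at x)"
    by (auto intro!: derivative_eq_intros)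
  ultimately have "((\<lambda>x. (x - p) \<bullet> (A *v (x - p))) has_derivative
      (\<lambda>v. (x - p) \<bullet> (A *v v) + v \<bullet> (A *v (x - p)))) (at x)"
    by (intro has_derivative_inner)
  then show ?thesis
    by (rule has_derivative_eq_rhs)
      (auto simp: symmetric_inner_commute[OF assms, of _ "x - p"] fun_eq_iff)
qed

lemma heat_kernel_ln_second_derivatives:
  fixes A :: "real ^ 'n ^ 'n::finite"
  assumes A: "symmetric_pos_def A" and t: "0 < t"
  shows "second_derivatives (\<lambda>x. ln (heat_kernel A p t x))
    (\<lambda>x v. - ((x - p) \<bullet> (A *v v)) / (2 * t)) (\<lambda>x v w. - (w \<bullet> (A *v v)) / (2 * t))"
proof -
  define q where "q = (\<lambda>x. (x - p) \<bullet> (A *v (x - p)))"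
  have q: "(q has_derivative (\<lambda>v. 2 * ((x - p) \<bullet> (A *v v)))) (at x)" for x
    unfolding q_def by (rule quadratic_form_has_derivative[OF A])
  have "((\<lambda>x. - (real CARD('n) / 2) * ln t - q x / (4 * t)) has_derivative
      (\<lambda>v. - ((x - p) \<bullet> (A *v v)) / (2 * t))) (at x)" for x
    using t by (auto intro!: derivative_eq_intros q)
  moreover have "((\<lambda>x. - ((x - p) \<bullet> (A *v v)) / (2 * t)) has_derivative
      (\<lambda>w. - (w \<bullet> (A *v v)) / (2 * t))) (at x)" for x v
    using t by (auto intro!: derivative_eq_intros)
  ultimately show ?thesis
    unfolding second_derivatives_def heat_kernel_def ln_exp q_def by blast
qed

lemma heat_kernel_grad:
  assumes A: "symmetric_pos_def A" and t: "0 < t"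
  shows "(heat_kernel A p t has_derivative
    (\<lambda>v. - heat_kernel A p t x / (2 * t) * ((x - p) \<bullet> (A *v v)))) (at x)"
proof -
  have "((\<lambda>x. ln (heat_kernel A p t x)) has_derivative (\<lambda>v. - ((x - p) \<bullet> (A *v v)) / (2 * t))) (at x)"
    using heat_kernel_ln_second_derivatives[OF assms] unfolding second_derivatives_def by blast
  from has_derivative_exp[OF this] show ?thesis
    by (simp add: heat_kernel_pos mult.commute fun_eq_iff)
qed

lemma matrix_inv_cancel:
  fixes A :: "real ^ 'n ^ 'n::finite"
  assumes "symmetric_pos_def A"
  shows "matrix_inv A *v (A *v w) = w"
proof -
  have "inj ((*v) A)"
  proof (rule injI)
    fix x y assume "A *v x = A *v y"
    then have "(x - y) \<bullet> (A *v (x - y)) = 0"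
      by (simp add: matrix_vector_mult_diff_distrib)
    then show "x = y"
      using assms unfolding symmetric_pos_def_def by (metis eq_iff_diff_eq_0 less_irrefl)
  qed
  then have "invertible A"
    using invertible_left_inverse matrix_left_invertible_injective by blast
  then have "matrix_inv A ** A = mat 1"
    unfolding invertible_def matrix_inv_def by (rule someI2_ex) blast
  then show ?thesis by (simp add: matrix_vector_mul_assoc)
qed

text \<open>The gradient of the kernel is \<open>-u / 2t\<close> times \<open>A (x - p)\<close>, so \<open>A\<^sup>-\<^sup>1\<close> cancels \<open>A\<close> and the flux is the
  radial field \<open>-u / 2t\<close> times \<open>x - p\<close>.\<close>
lemma heat_kernel_divergence:
  fixes A :: "real ^ 'n ^ 'n::finite"
  assumes A: "symmetric_pos_def A" and t: "0 < t"
  shows "divergence (\<lambda>y. matrix_inv A *v grad (heat_kernel A p t) y) x =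
    heat_kernel A p t x * (((x - p) \<bullet> (A *v (x - p))) / (4 * t\<^sup>2) - real CARD('n) / (2 * t))"
proof -
  let ?u = "heat_kernel A p t"
  have "grad ?u y = (- ?u y / (2 * t)) *\<^sub>R (A *v (y - p))" for y
    unfolding grad_def partial_eq[OF heat_kernel_grad[OF assms]]
    by (simp add: vec_eq_iff symmetric_inner_commute[OF A, of "y - p"] inner_axis')
  then have flux: "matrix_inv A *v grad ?u y = (- ?u y / (2 * t)) *\<^sub>R (y - p)" for y
    by (simp only: matrix_vector_mult_scaleR matrix_inv_cancel[OF A])
  have "partial i (\<lambda>y. ((- ?u y / (2 * t)) *\<^sub>R (y - p)) $ i) x =
      ?u x / (4 * t\<^sup>2) * ((x - p) $ i * (A *v (x - p)) $ i) - ?u x / (2 * t)" for i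
  proof -
    have c: "((\<lambda>y. y $ i) has_derivative (\<lambda>v. v $ i)) (at x)"
      by (rule bounded_linear.has_derivative[OF bounded_linear_vec_nth has_derivative_ident])
    have "((\<lambda>y. - ?u y / (2 * t) * (y $ i - p $ i)) has_derivative
        (\<lambda>v. - ?u x / (2 * t) * (v $ i) +
          ?u x / (4 * t\<^sup>2) * ((x - p) \<bullet> (A *v v)) * (x $ i - p $ i))) (at x)"
      using t by (auto intro!: derivative_eq_intros heat_kernel_grad[OF assms] c
          simp: fun_eq_iff field_simps power2_eq_square)
    moreover have "axis i (1::real) $ i = 1"
      by (simp add: axis_def)
    ultimately show ?thesis
      using partial_eq
      by (fastforce simp: symmetric_inner_commute[OF A, of "x - p"] inner_axis' mult_ac)
  qed
  then have "divergence (\<lambda>y. matrix_inv A *v grad ?u y) x =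
      ?u x / (4 * t\<^sup>2) * ((x - p) \<bullet> (A *v (x - p))) - real CARD('n) * (?u x / (2 * t))"
    unfolding divergence_def flux by (simp add: sum_subtractf inner_vec_def sum_distrib_left)
  then show ?thesis by (simp add: right_diff_distrib mult.commute)
qed

lemma heat_kernel_solution:
  assumes A: "symmetric_pos_def A"
  shows "positive_heat_solution A (heat_kernel A p)"
  unfolding positive_heat_solution_def
proof (intro conjI allI impI)
  show "positive_on_times (heat_kernel A p)"
    by (simp add: positive_on_times_def heat_kernel_pos)
  show "C2_on ({0<..} \<times> UNIV) (\<lambda>(t, x). heat_kernel A p t x)"
    using C2_on_heat_kernel[OF C2_on_bounded_linear[OF bounded_linear_fst] _ bounded_linear_snd,
        of "{0<..} \<times> UNIV" A p]
    by (simp add: case_prod_beta' image_subset_iff)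
  fix t :: real and x assume t: "0 < t"
  show "((\<lambda>s. heat_kernel A p s x) has_real_derivative
      divergence (\<lambda>y. matrix_inv A *v grad (heat_kernel A p t) y) x) (at t)"
    unfolding heat_kernel_divergence[OF A t] unfolding heat_kernel_def
    using t by (auto intro!: derivative_eq_intros simp: field_simps power2_eq_square)
qed

text \<open>The inequality holds with equality: the Hessian of the logarithm is the matrix \<open>-A/2t\<close>.\<close>
lemma heat_kernel_log_convexity:
  assumes A: "symmetric_pos_def A"
  shows "log_convexity A (heat_kernel A p)"
  unfolding log_convexity_def
  by (auto simp: log_convex_at_iff[OF heat_kernel_ln_second_derivatives[OF A]])

section \<open>The profile of a homogeneous function\<close>

text \<open>Scaling by \<open>exp x\<close> moves \<open>(1, exp (y - x))\<close> to \<open>(exp x, exp y)\<close>.\<close>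
lemma Theta_eq_profile:
  assumes "homogeneous_1 B" and pos: "\<forall>x\<in>quadrant. 0 < B x"
  shows "Theta B (x, y) = x + Theta B (0, y - x)"
proof -
  have "B (exp x, exp y) = B (exp x *\<^sub>R (1, exp (y - x)))"
    by (simp add: exp_diff)
  also have "\<dots> = exp x * B (1, exp (y - x))"
    using assms(1)[unfolded homogeneous_1_def, rule_format, of "exp x" "(1, exp (y - x))"] by simp
  finally have "B (exp x, exp y) = exp x * B (1, exp (y - x))" .
  moreover have "0 < B (1, exp (y - x))"
    using pos by simp
  ultimately show ?thesis
    by (simp add: Theta_def ln_mult)
qed

lemma ln_eq_profile:
  assumes "homogeneous_1 B" and "\<forall>x\<in>quadrant. 0 < B x" and "0 < a" "0 < b"
  shows "ln (B (a, b)) = ln a + Theta B (0, ln b - ln a)"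
  using Theta_eq_profile[OF assms(1,2), of "ln a" "ln b"] assms(3,4) by (simp add: Theta_def)

lemma profile_second_derivative:
  assumes C2: "C2_on quadrant B" and pos: "\<forall>x\<in>quadrant. 0 < B x"
  obtains h' h'' where
    "\<And>s. ((\<lambda>s. Theta B (0, s)) has_real_derivative h' s) (at s)"
    "\<And>s. (h' has_real_derivative h'' s) (at s)"
proof -
  obtain B' B'' where B: "\<And>x. x \<in> quadrant \<Longrightarrow> (B has_derivative blinfun_apply (B' x)) (at x)"
      "\<And>x. x \<in> quadrant \<Longrightarrow> (B' has_derivative blinfun_apply (B'' x)) (at x)"
    using C2 unfolding C2_on_def by blast
  \<comment> \<open>\<open>b\<close> restricts \<open>B\<close> to the vertical line through \<open>(1, 0)\<close>, so the profile is \<open>ln (b (exp s))\<close>.\<close>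
  define b b1 b2 where "b = (\<lambda>y. B (1, y))" and "b1 = (\<lambda>y. B' (1, y) (0, 1))"
    and "b2 = (\<lambda>y. B'' (1, y) (0, 1) (0, 1))"
  have line: "((\<lambda>y::real. (1::real, y)) has_derivative (\<lambda>v. (0, v))) (at y)" for y
    by (auto intro!: derivative_eq_intros)
  have sc: "(0::real, v) = v *\<^sub>R (0, 1)" for v :: real by simp
  have b: "(b has_real_derivative b1 y) (at y)" if "0 < y" for y
  proof -
    have "(b has_derivative (\<lambda>v. B' (1, y) (0, v))) (at y)"
      unfolding b_def by (rule has_derivative_compose[OF line B(1)]) (use that in auto)
    then show ?thesis
      unfolding has_field_derivative_def b1_def
      by (rule has_derivative_eq_rhs) (subst sc, auto simp only: blinfun.scaleR_right real_scaleR_def mult.commute fun_eq_iff)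
  qed
  have b1: "(b1 has_real_derivative b2 y) (at y)" if "0 < y" for y
  proof -
    have "((\<lambda>y. B' (1, y)) has_derivative (\<lambda>v. B'' (1, y) (0, v))) (at y)"
      by (rule has_derivative_compose[OF line B(2)]) (use that in auto)
    then have "(b1 has_derivative (\<lambda>v. B'' (1, y) (0, v) (0, 1))) (at y)"
      unfolding b1_def by (rule bounded_linear.has_derivative[OF blinfun.bounded_linear_left])
    then show ?thesis
      unfolding has_field_derivative_def b2_def
      by (rule has_derivative_eq_rhs) (subst sc, auto simp only: blinfun.scaleR_right blinfun.scaleR_left scaleR_blinfun.rep_eq real_scaleR_def mult.commute fun_eq_iff)
  qed
  have bpos: "0 < b (exp s)" for s using pos by (simp add: b_def)
  have be: "((\<lambda>s. b (exp s)) has_real_derivative b1 (exp s) * exp s) (at s)"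
      "((\<lambda>s. b1 (exp s)) has_real_derivative b2 (exp s) * exp s) (at s)" for s
    by (auto intro!: DERIV_chain2[OF b] DERIV_chain2[OF b1] derivative_eq_intros)
  have h1: "((\<lambda>s. Theta B (0, s)) has_real_derivative b1 (exp s) * exp s / b (exp s)) (at s)" for s
  proof -
    have "((\<lambda>s. ln (b (exp s))) has_real_derivative b1 (exp s) * exp s / b (exp s)) (at s)"
      using bpos[of s] by (auto intro!: derivative_eq_intros be simp: field_simps)
    then show ?thesis by (simp add: Theta_def b_def)
  qed
  have "((\<lambda>s. b1 (exp s) * exp s / b (exp s)) has_real_derivative
      ((b2 (exp s) * exp s * exp s + b1 (exp s) * exp s) * b (exp s) -
       b1 (exp s) * exp s * (b1 (exp s) * exp s)) / (b (exp s) * b (exp s))) (at s)" for s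
    using bpos[of s] by (auto intro!: derivative_eq_intros be simp: algebra_simps)
  from that[OF h1 this] show ?thesis .
qed

text \<open>The profile increases since \<open>B\<close> increases in its second variable. Since \<open>B\<close> increases in its first
  variable, so does \<open>s - \<Theta>(0, s) = - \<Theta>(-s, 0)\<close> as a function of \<open>s\<close>.\<close>
lemma profile_derivative_bounds:
  assumes inc: "increasing_each B" and hom: "homogeneous_1 B" and pos: "\<forall>x\<in>quadrant. 0 < B x"
    and h: "((\<lambda>s. Theta B (0, s)) has_real_derivative D) (at s)"
  shows "0 \<le> D" "D \<le> 1"
proof -
  have mono: "Theta B (0, x) \<le> Theta B (0, y)" if "x \<le> y" for x y
    using inc pos that unfolding increasing_each_def Theta_def by (auto intro!: ln_mono)
  then show "0 \<le> D"
    by (intro mono_on_imp_deriv_nonneg[OF _ h, of UNIV]) (auto simp: mono_on_def)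
  have "Theta B (-x, 0) \<ge> Theta B (-y, 0)" if "x \<le> y" for x y
    using inc pos that unfolding increasing_each_def Theta_def by (auto intro!: ln_mono)
  then have "x - Theta B (0, x) \<le> y - Theta B (0, y)" if "x \<le> y" for x y
    using that Theta_eq_profile[OF hom pos, of "-x" 0] Theta_eq_profile[OF hom pos, of "-y" 0]
    by fastforce
  then have "0 \<le> 1 - D"
    by (intro mono_on_imp_deriv_nonneg[of UNIV "\<lambda>s. s - Theta B (0, s)" _ s])
      (auto simp: mono_on_def intro!: derivative_eq_intros h)
  then show "D \<le> 1" by simp
qed

text \<open>The tangent inequalities at two points add up to monotonicity of \<open>h'\<close>.\<close>
lemma convex_on_imp_second_derivative_nonneg:
  fixes h :: "real \<Rightarrow> real"
  assumes cvx: "convex_on UNIV h"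
    and h: "\<And>s. (h has_real_derivative h' s) (at s)" "\<And>s. (h' has_real_derivative h'' s) (at s)"
  shows "0 \<le> h'' s"
proof (rule mono_on_imp_deriv_nonneg[OF _ h(2), of UNIV])
  show "mono_on UNIV h'"
  proof (rule mono_onI)
    fix x y :: real assume "x \<le> y"
    have "h' x * (y - x) \<le> h y - h x" "h' y * (x - y) \<le> h x - h y"
      using convex_on_imp_above_tangent[OF cvx] h(1) by auto
    then have "0 \<le> (h' y - h' x) * (y - x)" by (simp add: algebra_simps)
    then show "h' x \<le> h' y"
      using \<open>x \<le> y\<close> by (cases "x = y") (auto simp: zero_le_mult_iff)
  qed
qed auto

text \<open>\<open>\<Theta>\<close> is linear plus the profile composed with the linear map \<open>(x, y) \<mapsto> y - x\<close>, so convexity passes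
  between \<open>\<Theta>\<close> and the profile in both directions.\<close>
lemma convex_on_Theta_iff:
  assumes hom: "homogeneous_1 B" and pos: "\<forall>x\<in>quadrant. 0 < B x"
    and h: "\<And>s. ((\<lambda>s. Theta B (0, s)) has_real_derivative h' s) (at s)"
      "\<And>s. (h' has_real_derivative h'' s) (at s)"
  shows "convex_on UNIV (Theta B) \<longleftrightarrow> (\<forall>s. 0 \<le> h'' s)"
proof
  assume cvx: "convex_on UNIV (Theta B)"
  have "convex_on UNIV (\<lambda>s. Theta B (0, s))"
  proof (rule convex_onI)
    fix t x y :: real assume "0 < t" "t < 1"
    then show "Theta B (0, (1 - t) *\<^sub>R x + t *\<^sub>R y) \<le> (1 - t) * Theta B (0, x) + t * Theta B (0, y)"
      using convex_onD[OF cvx, of t "(0, x)" "(0, y)"] by simp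
  qed auto
  from convex_on_imp_second_derivative_nonneg[OF this h] show "\<forall>s. 0 \<le> h'' s" by blast
next
  assume "\<forall>s. 0 \<le> h'' s"
  then have cvx: "convex_on UNIV (\<lambda>s. Theta B (0, s))"
    by (intro f''_ge0_imp_convex[OF _ h]) auto
  show "convex_on UNIV (Theta B)"
  proof (rule convex_onI)
    fix t :: real and x y :: "real \<times> real" assume t: "0 < t" "t < 1"
    let ?d = "\<lambda>z :: real \<times> real. snd z - fst z" and ?z = "(1 - t) *\<^sub>R x + t *\<^sub>R y"
    have split: "Theta B z = fst z + Theta B (0, ?d z)" for z
      using Theta_eq_profile[OF hom pos, of "fst z" "snd z"] by simp
    have "?d ?z = (1 - t) * ?d x + t * ?d y"
      by (simp add: algebra_simps)
    then have "Theta B (0, ?d ?z) \<le> (1 - t) * Theta B (0, ?d x) + t * Theta B (0, ?d y)"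
      using convex_onD[OF cvx, of t "?d x" "?d y"] t by simp
    moreover have "(1 - t) * Theta B x + t * Theta B y =
        fst ?z + ((1 - t) * Theta B (0, ?d x) + t * Theta B (0, ?d y))"
      by (simp add: split[of x] split[of y] algebra_simps)
    ultimately show "Theta B ?z \<le> (1 - t) * Theta B x + t * Theta B y"
      by (simp add: split[of ?z])
  qed auto
qed

text \<open>On a ball that misses the set, \<open>h'' \<ge> 0\<close> would make \<open>h\<close> convex, which contradicts strict concavity
  at a midpoint.\<close>
lemma strictly_concave_imp_dense_negative_curvature:
  fixes h :: "real \<Rightarrow> real"
  assumes conc: "strictly_concave h"
    and h: "\<And>s. (h has_real_derivative h' s) (at s)" "\<And>s. (h' has_real_derivative h'' s) (at s)"
  shows "closure {s. h'' s < 0} = UNIV"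
proof (rule ccontr)
  assume "closure {s. h'' s < 0} \<noteq> UNIV"
  then obtain s where "s \<in> - closure {s. h'' s < 0}" by auto
  then obtain e where e: "0 < e" "ball s e \<subseteq> - closure {s. h'' s < 0}"
    using open_contains_ball[of "- closure {s. h'' s < 0}"] by auto
  have "0 \<le> h'' x" if "x \<in> ball s e" for x
    using that e(2) closure_subset[of "{s. h'' s < 0}"] by (auto simp: not_less[symmetric])
  then have "convex_on (ball s e) h"
    by (intro f''_ge0_imp_convex[OF _ h]) auto
  from convex_onD[OF this, of "1/2" s "s + e/2"]
  have "h (1/2 * s + 1/2 * (s + e/2)) \<le> 1/2 * h s + 1/2 * h (s + e/2)"
    using e(1) by (simp add: dist_norm)
  moreover have "1/2 * h s + (1 - 1/2) * h (s + e/2) < h (1/2 * s + (1 - 1/2) * (s + e/2))"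
    using conc[unfolded strictly_concave_def, rule_format, of s "s + e/2" "1/2"] e(1) by simp
  ultimately show False by simp
qed

section \<open>Preservation and failure of log-convexity\<close>

text \<open>The term \<open>q v\<close> is distributed over the weights \<open>1 - h' s\<close> and \<open>h' s\<close>, which add up to \<open>1\<close>, so that
  the first two summands are the weighted defects of \<open>u\<close> and \<open>w\<close> in the inequality for each of them.\<close>
lemma log_convex_at_combine_iff:
  fixes A :: "real ^ 'n ^ 'n::finite" and x :: "real ^ 'n"
  assumes pos: "\<forall>x\<in>quadrant. 0 < B x" and hom: "homogeneous_1 B"
    and h: "\<And>s. ((\<lambda>s. Theta B (0, s)) has_real_derivative h' s) (at s)"
      "\<And>s. (h' has_real_derivative h'' s) (at s)"
    and u: "\<And>x. 0 < u t x" "second_derivatives (\<lambda>x. ln (u t x)) a' a''"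
    and w: "\<And>x. 0 < w t x" "second_derivatives (\<lambda>x. ln (w t x)) b' b''"
  defines "s \<equiv> ln (w t x) - ln (u t x)" and "q \<equiv> \<lambda>v. (v \<bullet> (A *v v)) / (2 * t)"
  shows "log_convex_at A (combine B u w) t x \<longleftrightarrow>
    (\<forall>v. 0 \<le> (1 - h' s) * (a'' x v v + q v) + h' s * (b'' x v v + q v) +
      h'' s * (b' x v - a' x v)\<^sup>2)"
proof -
  have "(\<lambda>x. ln (combine B u w t x)) =
      (\<lambda>x. ln (u t x) + Theta B (0, ln (w t x) - ln (u t x)))"
    by (simp add: combine_def ln_eq_profile[OF hom pos u(1) w(1)])
  with second_derivatives_interpolation[OF u(2) w(2) h]
  show ?thesis
    by (simp add: log_convex_at_iff s_def q_def algebra_simps power2_eq_square)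
qed

lemma preserves_log_convexity_if_profile_convex:
  fixes A :: "real ^ 'n ^ 'n::finite"
  assumes pos: "\<forall>x\<in>quadrant. 0 < B x" and inc: "increasing_each B" and hom: "homogeneous_1 B"
    and h: "\<And>s. ((\<lambda>s. Theta B (0, s)) has_real_derivative h' s) (at s)"
      "\<And>s. (h' has_real_derivative h'' s) (at s)"
    and nonneg: "\<And>s. 0 \<le> h'' s"
  shows "preserves_log_convexity A B"
  unfolding preserves_log_convexity_def log_convexity_def
proof (intro allI impI)
  fix u1 u2 :: "real \<Rightarrow> real ^ 'n \<Rightarrow> real" and t :: real and x
  assume u: "positive_on_times u1" "positive_on_times u2" "\<forall>t>0. C2_on UNIV (u1 t)"
    "\<forall>t>0. C2_on UNIV (u2 t)" "\<forall>t>0. \<forall>x. log_convex_at A u1 t x"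
    "\<forall>t>0. \<forall>x. log_convex_at A u2 t x" and t: "0 < t"
  have upos: "0 < u1 t y" "0 < u2 t y" for y
    using u(1,2) t unfolding positive_on_times_def by auto
  obtain a' a'' where a: "second_derivatives (\<lambda>x. ln (u1 t x)) a' a''"
    by (rule C2_on_imp_ln_second_derivatives[of "u1 t"]) (use u(3) t upos(1) in auto)
  obtain b' b'' where b: "second_derivatives (\<lambda>x. ln (u2 t x)) b' b''"
    by (rule C2_on_imp_ln_second_derivatives[of "u2 t"]) (use u(4) t upos(2) in auto)
  let ?s = "ln (u2 t x) - ln (u1 t x)"
  show "log_convex_at A (combine B u1 u2) t x"
    unfolding log_convex_at_combine_iff[where u = u1 and w = u2 and t = t,
        OF pos hom h upos(1) a upos(2) b]
  proof
    fix v
    let ?q = "(v \<bullet> (A *v v)) / (2 * t)"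
    have "log_convex_at A u1 t x" "log_convex_at A u2 t x"
      using u(5,6) t by simp_all
    then have "0 \<le> a'' x v v + ?q" "0 \<le> b'' x v v + ?q"
      by (simp_all only: log_convex_at_iff[where u = u1 and t = t, OF a]
          log_convex_at_iff[where u = u2 and t = t, OF b])
    moreover have "0 \<le> h' ?s" "h' ?s \<le> 1"
      using profile_derivative_bounds[OF inc hom pos h(1)] by auto
    ultimately show "0 \<le> (1 - h' ?s) * (a'' x v v + ?q) + h' ?s * (b'' x v v + ?q) +
        h'' ?s * (b' x v - a' x v)\<^sup>2"
      using nonneg by (intro add_nonneg_nonneg[OF add_nonneg_nonneg] mult_nonneg_nonneg) auto
  qed
qed

text \<open>Both defects of the kernels vanish, which leaves \<open>h''\<close> times the square of a derivative of the
  affine function, the difference of the two logarithms. In the direction \<open>p\<close> this derivative is \<open>p \<bullet> A p / 2t > 0\<close>, so the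
  sign of \<open>h''\<close> alone decides.\<close>
lemma log_convex_at_combine_heat_kernels:
  fixes A :: "real ^ 'n ^ 'n::finite"
  assumes A: "symmetric_pos_def A" and t: "0 < t" and p: "p \<noteq> 0"
    and pos: "\<forall>x\<in>quadrant. 0 < B x" and hom: "homogeneous_1 B"
    and h: "\<And>s. ((\<lambda>s. Theta B (0, s)) has_real_derivative h' s) (at s)"
      "\<And>s. (h' has_real_derivative h'' s) (at s)"
  shows "log_convex_at A (combine B (heat_kernel A 0) (heat_kernel A p)) t x \<longleftrightarrow>
    0 \<le> h'' (((1 / (2 * t)) *\<^sub>R (A *v p)) \<bullet> x + - (p \<bullet> (A *v p)) / (4 * t))"
    (is "_ \<longleftrightarrow> 0 \<le> h'' ?s")
proof -
  have s: "ln (heat_kernel A p t x) - ln (heat_kernel A 0 t x) = ?s"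
    using t by (simp add: heat_kernel_def matrix_vector_mult_diff_distrib inner_diff inner_commute[of "A *v p"]
        symmetric_inner_commute[OF A, of p x] field_simps)
  have slope: "- ((x - p) \<bullet> (A *v v)) / (2 * t) - - ((x - 0) \<bullet> (A *v v)) / (2 * t) =
      (p \<bullet> (A *v v)) / (2 * t)" for v
    using t by (simp add: inner_diff_left field_simps)
  have "log_convex_at A (combine B (heat_kernel A 0) (heat_kernel A p)) t x \<longleftrightarrow>
      (\<forall>v. 0 \<le> h'' ?s * ((p \<bullet> (A *v v)) / (2 * t))\<^sup>2)"
    unfolding log_convex_at_combine_iff[where u = "heat_kernel A 0" and w = "heat_kernel A p" and t = t,
        OF pos hom h heat_kernel_pos heat_kernel_ln_second_derivatives[OF A t]
          heat_kernel_pos heat_kernel_ln_second_derivatives[OF A t]] s slope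
    by simp
  also have "\<dots> \<longleftrightarrow> 0 \<le> h'' ?s"
  proof
    assume "\<forall>v. 0 \<le> h'' ?s * ((p \<bullet> (A *v v)) / (2 * t))\<^sup>2"
    then have "0 \<le> h'' ?s * ((p \<bullet> (A *v p)) / (2 * t))\<^sup>2" by blast
    moreover have "0 < ((p \<bullet> (A *v p)) / (2 * t))\<^sup>2"
      using A p t unfolding symmetric_pos_def_def by (metis divide_pos_pos mult_pos_pos zero_less_numeral zero_less_power)
    ultimately show "0 \<le> h'' ?s" by (simp add: zero_le_mult_iff)
  qed auto
  finally show ?thesis .
qed

text \<open>Along the line through a point in direction \<open>p\<close> the affine function is a homeomorphism onto the
  reals, so points of \<open>S\<close> near its value lift to points of that line near the given point.\<close>
lemma closure_affine_vimage:
  fixes p w :: "'a::real_inner"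
  assumes dense: "closure S = UNIV" and nz: "w \<bullet> p \<noteq> 0"
  shows "closure {x. w \<bullet> x + c \<in> S} = UNIV"
proof -
  have "x \<in> closure {x. w \<bullet> x + c \<in> S}" for x
  proof -
    let ?g = "\<lambda>s. x + ((s - (w \<bullet> x + c)) / (w \<bullet> p)) *\<^sub>R p"
    have "?g ` closure S \<subseteq> closure {x. w \<bullet> x + c \<in> S}"
    proof (rule image_closure_subset)
      show "?g ` S \<subseteq> closure {x. w \<bullet> x + c \<in> S}"
      proof
        fix y assume "y \<in> ?g ` S"
        then have "w \<bullet> y + c \<in> S" using nz by (auto simp: inner_add_right)
        then show "y \<in> closure {x. w \<bullet> x + c \<in> S}"
          by (auto intro!: closure_subset[THEN subsetD])
      qed
    qed (auto intro!: continuous_intros simp: nz)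
    moreover have "x = ?g (w \<bullet> x + c)" by simp
    ultimately show ?thesis unfolding dense by blast
  qed
  then show ?thesis by auto
qed

theorem theorem3p2:
  fixes A :: "real ^ 'n ^ 'n"
    and B :: "real \<times> real \<Rightarrow> real"
  assumes "symmetric_pos_def A"
    and "\<forall>x\<in>quadrant. 0 < B x"
    and "C2_on quadrant B"
    and "increasing_each B"
    and "homogeneous_1 B"
  shows "(preserves_log_convexity A B \<longleftrightarrow> convex_on UNIV (Theta B)) \<and>
    (differentially_strictly_concave (\<lambda>s. Theta B (0, s)) \<longrightarrow>
      (\<exists>u1 u2 :: real \<Rightarrow> real ^ 'n \<Rightarrow> real.
        positive_heat_solution A u1 \<and> positive_heat_solution A u2 \<and>
        (\<forall>t>0. \<forall>x. \<not> log_convex_at A (combine B u1 u2) t x))) \<and>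
    (strictly_concave (\<lambda>s. Theta B (0, s)) \<longrightarrow>
      (\<exists>u1 u2 :: real \<Rightarrow> real ^ 'n \<Rightarrow> real.
        positive_heat_solution A u1 \<and> positive_heat_solution A u2 \<and>
        (\<forall>t>0. closure {x. \<not> log_convex_at A (combine B u1 u2) t x} = UNIV)))"
proof -
  note A = assms(1) and pos = assms(2) and hom = assms(5)
  obtain h' h'' where h: "\<And>s. ((\<lambda>s. Theta B (0, s)) has_real_derivative h' s) (at s)"
      "\<And>s. (h' has_real_derivative h'' s) (at s)"
    using profile_second_derivative[OF assms(3) pos] by blast
  define p :: "real ^ 'n" where "p = axis undefined 1"
  have p: "p \<noteq> 0" by (simp add: p_def axis_eq_0_iff)
  have App: "0 < p \<bullet> (A *v p)"
    using A p unfolding symmetric_pos_def_def by blast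
  let ?u1 = "heat_kernel A 0" and ?u2 = "heat_kernel A p"
  let ?w = "\<lambda>t. (1 / (2 * t)) *\<^sub>R (A *v p)" and ?c = "\<lambda>t. - (p \<bullet> (A *v p)) / (4 * t)"
  have slope: "?w t \<bullet> p \<noteq> 0" if "0 < t" for t
    using that App by (simp add: inner_commute[of "A *v p"])
  have iff: "log_convex_at A (combine B ?u1 ?u2) t x \<longleftrightarrow> 0 \<le> h'' (?w t \<bullet> x + ?c t)" if "0 < t" for t x
    by (rule log_convex_at_combine_heat_kernels[OF A that p pos hom h])
  have "0 \<le> h'' s" if "preserves_log_convexity A B" for s
  proof -
    have "C2_on UNIV (heat_kernel A q t)" if "0 < t" for q t
      using C2_on_heat_kernel[OF C2_on_const _ bounded_linear_ident, of t UNIV A q] that by auto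
    then have "log_convexity A (combine B ?u1 ?u2)"
      using that heat_kernel_log_convexity[OF A]
      unfolding preserves_log_convexity_def positive_on_times_def by (simp add: heat_kernel_pos)
    \<comment> \<open>The affine function takes the prescribed value \<open>s\<close> at a suitable multiple of \<open>p\<close>.\<close>
    moreover have "?w 1 \<bullet> (((s - ?c 1) / (?w 1 \<bullet> p)) *\<^sub>R p) + ?c 1 = s"
      using slope[of 1] by (simp only: inner_scaleR_right) (simp add: field_simps)
    ultimately show ?thesis
      unfolding log_convexity_def using iff[of 1] by (metis zero_less_one)
  qed
  then have "preserves_log_convexity A B \<longleftrightarrow> convex_on UNIV (Theta B)"
    using convex_on_Theta_iff[OF hom pos h]
      preserves_log_convexity_if_profile_convex[OF pos assms(4) hom h] by blast
  moreover have "\<forall>t>0. \<forall>x. \<not> log_convex_at A (combine B ?u1 ?u2) t x"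
    if "differentially_strictly_concave (\<lambda>s. Theta B (0, s))"
  proof -
    have "deriv (\<lambda>s. Theta B (0, s)) = h'" using DERIV_imp_deriv[OF h(1)] by auto
    then have "h'' s < 0" for s
      using that DERIV_imp_deriv[OF h(2)] unfolding differentially_strictly_concave_def by simp
    then show ?thesis using iff by (simp add: not_le)
  qed
  moreover have "\<forall>t>0. closure {x. \<not> log_convex_at A (combine B ?u1 ?u2) t x} = UNIV"
    if "strictly_concave (\<lambda>s. Theta B (0, s))"
  proof (intro allI impI)
    fix t :: real assume t: "0 < t"
    show "closure {x. \<not> log_convex_at A (combine B ?u1 ?u2) t x} = UNIV"
      using closure_affine_vimage[OF strictly_concave_imp_dense_negative_curvature[OF that h] slope[OF t], of "?c t"]
      by (simp add: iff[OF t] not_le)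
  qed
  ultimately show ?thesis
    using heat_kernel_solution[OF A] by blast
qed

end
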